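(* Let $m=6j-1$ be a prime, where $j$ is a positive integer. Then for every integer $n\geq 0$ such that $m \mid p(n,3)$, and for every $i\in\{0,1,\ldots,m-1\}$, $$\#\{\lambda\in P(n,3) : \lambda_1-\lambda_3\equiv i \pmod m\} = \frac{p(n,3)}{m}.$$ That is, the statistic $c_{LS}(\lambda)=\lambda_1-\lambda_3 \bmod m$ (largest part minus smallest part modulo $m$) is a supercrank for partitions into three parts modulo $m$.
   Context: For an integer $n\ge 0$, $P(n,3)$ denotes the set of partitions of $n$ into exactly three parts, identified with integer vectors $\lambda=(\lambda_1,\lambda_2,\lambda_3)\in\mathbb{Z}^3$ with $\lambda_1+\lambda_2+\lambda_3=n$ and $\lambda_1\geq\lambda_2\geq\lambda_3>0$; $p(n,3)=\#P(n,3)$. A function $c$ defined on $\bigcup_{n\ge0}P(n,3)$ with values in $\{0,\ldots,m-1\}$ is called a supercrank (modulo $m$) if for every $n$ with $m\mid p(n,3)$ all the classes $c^{-1}(i)\cap P(n,3)$, $i=0,\ldots,m-1$, have the same size. *)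

theory Defs
  imports "HOL-Number_Theory.Number_Theory"
begin

definition P3 :: "nat \<Rightarrow> (int \<times> int \<times> int) set" where
  "P3 n = {(l1, l2, l3). l1 + l2 + l3 = int n \<and> l1 \<ge> l2 \<and> l2 \<ge> l3 \<and> l3 > 0}"

definition p3 :: "nat \<Rightarrow> nat" where
  "p3 n = card (P3 n)"

(* c is a total HOL function; its values outside the union of the P3 n are irrelevant. *)
definition supercrank :: "nat \<Rightarrow> (int \<times> int \<times> int \<Rightarrow> int) \<Rightarrow> bool" where
  "supercrank m c \<longleftrightarrow>
     c ` (\<Union>n. P3 n) \<subseteq> {0..<int m} \<and>
     (\<forall>n. m dvd p3 n \<longrightarrow>
        (\<forall>i\<in>{0..<int m}. \<forall>k\<in>{0..<int m}.
           card (c -` {i} \<inter> P3 n) = card (c -` {k} \<inter> P3 n)))"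

definition c_LS :: "nat \<Rightarrow> int \<times> int \<times> int \<Rightarrow> int" where
  "c_LS m = (\<lambda>(l1, l2, l3). (l1 - l3) mod int m)"

end

theory Submission
  imports Defs
begin

text \<open>Writing \<open>s = n - 3 * l3\<close>, the partitions of \<open>n\<close> with smallest part \<open>l3\<close> realise each
  difference \<open>l1 - l3\<close> between \<open>(s + 1) div 2\<close> and \<open>s\<close> exactly once. Hence the sum of
  \<open>g (d + 1) - g d\<close> over all differences \<open>d\<close> telescopes to sums of \<open>g\<close> along arithmetic progressions
  with step 3. For \<open>g\<close> the identity this evaluates \<open>p3 n\<close>. For \<open>g\<close> periodic modulo \<open>m\<close> the
  progressions cancel as soon as \<open>m\<close> divides \<open>p3 n\<close>, because \<open>p3 (6 * k + r)\<close> factors into linear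
  terms in \<open>k\<close>, except for \<open>r = 3\<close>, where a prime divisor congruent to 2 modulo 3 would produce a
  primitive cube root of unity. Applied to the indicator of a residue class,
  this shows that neighbouring classes have the same size.\<close>

section \<open>Sums along arithmetic progressions with step 3\<close>

definition sum3 :: "(int \<Rightarrow> int) \<Rightarrow> int \<Rightarrow> nat \<Rightarrow> int" where
  "sum3 g a N = (\<Sum>t<N. g (a + 3 * int t))"

lemma sum3_0 [simp]: "sum3 g a 0 = 0"
  by (simp add: sum3_def)

lemma sum3_Suc: "sum3 g a (Suc N) = sum3 g a N + g (a + 3 * int N)"
  by (simp add: sum3_def)

lemma sum3_add: "sum3 g a (M + N) = sum3 g a M + sum3 g (a + 3 * int M) N"
  by (induction N) (simp_all add: sum3_Suc algebra_simps)

lemma double_sum3_id: "2 * sum3 (\<lambda>x. x) a N = 2 * a * int N + 3 * int N * (int N - 1)"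
  by (induction N) (simp_all add: sum3_Suc algebra_simps)

lemma periodic_cong:
  fixes g :: "int \<Rightarrow> 'a"
  assumes "\<And>x. g (x mod m) = g x" and "[a = b] (mod m)"
  shows "g a = g b"
  by (metis assms cong_def)

lemma sum3_cong:
  assumes "\<And>x. g (x mod m) = g x" and "[a = b] (mod m)"
  shows "sum3 g a N = sum3 g b N"
  unfolding sum3_def
  by (intro sum.cong refl periodic_cong[of g m, OF assms(1)] cong_add[OF assms(2) cong_refl])

text \<open>As 3 is invertible modulo \<open>m\<close>, any \<open>m\<close> consecutive terms of
  the progression meet each residue exactly once.\<close>

lemma sum3_period:
  fixes m :: nat
  assumes g: "\<And>x. g (x mod int m) = g x" and "coprime 3 (int m)" "m > 0"
  shows "sum3 g a m = (\<Sum>x\<in>{0..<int m}. g x)"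
proof -
  have inj: "inj_on (\<lambda>t. (a + 3 * int t) mod int m) {..<m}"
  proof
    fix t u assume tu: "t \<in> {..<m}" "u \<in> {..<m}"
      and "(a + 3 * int t) mod int m = (a + 3 * int u) mod int m"
    then have "[a + 3 * int t = a + 3 * int u] (mod int m)"
      by (simp add: cong_def)
    then have "[int t = int u] (mod int m)"
      using assms(2) by (simp add: cong_add_lcancel cong_mult_lcancel)
    then show "t = u"
      using tu by (simp add: cong_def)
  qed
  have "(\<lambda>t. (a + 3 * int t) mod int m) ` {..<m} = {0..<int m}"
    using \<open>m > 0\<close> inj by (intro card_subset_eq) (auto simp: card_image)
  then have "(\<Sum>x\<in>{0..<int m}. g x) = (\<Sum>t<m. g ((a + 3 * int t) mod int m))"
    using sum.reindex[OF inj, of g] by simp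
  then show ?thesis
    by (simp add: g sum3_def)
qed

lemma sum3_multiple:
  fixes m :: nat
  assumes g: "\<And>x. g (x mod int m) = g x" and c: "coprime 3 (int m)" "m > 0" and "m dvd N"
  shows "sum3 g a N = int (N div m) * (\<Sum>x\<in>{0..<int m}. g x)"
proof -
  have "sum3 g a (q * m) = int q * (\<Sum>x\<in>{0..<int m}. g x)" for q
    by (induction q arbitrary: a)
      (simp_all add: sum3_add sum3_period[of g m, OF g c] algebra_simps)
  then show ?thesis
    using assms by (metis dvd_div_mult_self)
qed

section \<open>Telescoping over the partitions\<close>

lemma sum_int_telescope:
  fixes g :: "int \<Rightarrow> int"
  assumes "a \<le> b + 1"
  shows "(\<Sum>d\<in>{a..b}. g (d + 1) - g d) = g (b + 1) - g a"
proof -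
  have "(\<Sum>d\<in>{a..c - 1}. g (d + 1) - g d) = g c - g a" if "a \<le> c" for c
    using that
  proof (induction c rule: int_ge_induct)
    case (step c)
    then have "{a..c + 1 - 1} = insert c {a..c - 1}"
      by auto
    then show ?case
      using step by simp
  qed simp
  from this[of "b + 1"] assms show ?thesis by simp
qed

text \<open>Put \<open>l3 = n div 3 - t\<close>, \<open>d = l1 - l3\<close> and
  \<open>s = n - 3 * l3\<close>. Then \<open>l2 \<ge> l3\<close> means \<open>d \<le> s\<close>,
  \<open>l1 \<ge> l2\<close> means \<open>2 * d \<ge> s\<close>, and \<open>l3 > 0\<close> means
  \<open>t < n div 3\<close>.\<close>

lemma sum_P3:
  fixes f :: "int \<Rightarrow> int"
  shows "(\<Sum>(l1, l2, l3)\<in>P3 n. f (l1 - l3)) =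
    (\<Sum>t<n div 3. \<Sum>d\<in>{(int (n mod 3) + 3 * int t + 1) div 2..int (n mod 3) + 3 * int t}. f d)"
proof -
  define s where "s t = int (n mod 3) + 3 * int t" for t
  define q where "q = int (n div 3)"
  have n: "int n = int (n mod 3) + 3 * q"
    unfolding q_def by presburger
  have "(\<Sum>(t, d)\<in>Sigma {..<n div 3} (\<lambda>t. {(s t + 1) div 2..s t}). f d) =
      (\<Sum>(l1, l2, l3)\<in>P3 n. f (l1 - l3))"
    by (rule sum.reindex_bij_witness[where
        i = "\<lambda>(l1, l2, l3). (nat (q - l3), l1 - l3)" and
        j = "\<lambda>(t, d). (q - int t + d, int n - 2 * (q - int t) - d, q - int t)"])
      (use n in \<open>auto simp: P3_def s_def q_def\<close>)
  then show ?thesis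
    by (simp add: sum.Sigma s_def)
qed

lemma finite_P3 [simp]: "finite (P3 n)"
proof (rule finite_subset)
  show "P3 n \<subseteq> {0..int n} \<times> {0..int n} \<times> {0..int n}"
    by (auto simp: P3_def)
qed simp

lemma sum_P3_diff:
  fixes g :: "int \<Rightarrow> int"
  shows "(\<Sum>(l1, l2, l3)\<in>P3 n. g (l1 - l3 + 1) - g (l1 - l3)) =
    (\<Sum>t<n div 3. g (int (n mod 3) + 3 * int t + 1) - g ((int (n mod 3) + 3 * int t + 1) div 2))"
  by (subst sum_P3[of "\<lambda>d. g (d + 1) - g d"]) (intro sum.cong refl sum_int_telescope, linarith)

text \<open>Advancing \<open>t\<close> by 2 raises the halved argument by exactly 3, so even and odd
  \<open>t\<close> contribute one progression of step 3 each.\<close>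

lemma sum_split_parity:
  fixes g :: "int \<Rightarrow> int"
  shows "(\<Sum>t<2 * k. g (a + 3 * int t + 1) - g ((a + 3 * int t + 1) div 2)) =
    sum3 g (a + 1) (2 * k) - sum3 g ((a + 1) div 2) k - sum3 g ((a + 4) div 2) k"
proof (induction k)
  case (Suc k)
  have "(a + 3 * int (2 * k) + 1) div 2 = (a + 1) div 2 + 3 * int k"
       "(a + 3 * int (Suc (2 * k)) + 1) div 2 = (a + 4) div 2 + 3 * int k"
    by presburger+
  then show ?case
    using Suc by (simp add: sum3_Suc algebra_simps)
qed simp

lemma sum_P3_diff_low:
  fixes g :: "int \<Rightarrow> int"
  assumes "r < 3"
  shows "(\<Sum>(l1, l2, l3)\<in>P3 (6 * k + r). g (l1 - l3 + 1) - g (l1 - l3)) =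
    sum3 g (int r + 1) (2 * k) - sum3 g ((int r + 1) div 2) k - sum3 g ((int r + 4) div 2) k"
proof -
  have "(6 * k + r) div 3 = 2 * k" "(6 * k + r) mod 3 = r"
    using assms by presburger+
  then show ?thesis
    by (simp only: sum_P3_diff sum_split_parity)
qed

text \<open>There are now \<open>2 * k + 1\<close> values of \<open>t\<close>. The last one,
  \<open>t = 2 * k\<close>, is even, so only the progression of the even \<open>t\<close> gains a
  term.\<close>

lemma sum_P3_diff_high:
  fixes g :: "int \<Rightarrow> int"
  assumes "r < 3"
  shows "(\<Sum>(l1, l2, l3)\<in>P3 (6 * k + 3 + r). g (l1 - l3 + 1) - g (l1 - l3)) =
    sum3 g (int r + 1) (2 * k + 1) - sum3 g ((int r + 1) div 2) (k + 1) - sum3 g ((int r + 4) div 2) k"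
proof -
  have n: "(6 * k + 3 + r) div 3 = Suc (2 * k)" "(6 * k + 3 + r) mod 3 = r"
    using assms by presburger+
  have "(int r + 3 * int (2 * k) + 1) div 2 = (int r + 1) div 2 + 3 * int k"
    by presburger
  then show ?thesis
    using sum_split_parity[of g "int r" k]
    by (simp only: sum_P3_diff n sum.lessThan_Suc Suc_eq_plus1[symmetric] sum3_Suc)
      (simp add: algebra_simps)
qed

section \<open>Closed forms of \<open>p3\<close>\<close>

lemma p3_eq_sum: "int (p3 n) = (\<Sum>(l1, l2, l3)\<in>P3 n. (l1 - l3 + 1) - (l1 - l3))"
  by (simp add: p3_def case_prod_unfold)

lemma p3_values:
  "p3 (6 * k) = 3 * k * k"
  "p3 (6 * k + 1) = k * (3 * k + 1)"
  "p3 (6 * k + 2) = k * (3 * k + 2)"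
  "p3 (6 * k + 3) = 3 * k * k + 3 * k + 1"
  "p3 (6 * k + 4) = (3 * k + 1) * (k + 1)"
  "p3 (6 * k + 5) = (3 * k + 2) * (k + 1)"
proof -
  note low = sum_P3_diff_low[of _ "\<lambda>x. x" k, folded p3_eq_sum]
  note high = sum_P3_diff_high[of _ "\<lambda>x. x" k, folded p3_eq_sum]
  \<comment> \<open>Each identity is doubled to match \<open>double_sum3_id\<close>, which avoids
    halves; the factor 2 is cancelled at the end.\<close>
  have "2 * int (p3 (6 * k)) = 2 * int (3 * k * k)"
    using low[of 0] double_sum3_id[of 1 "2 * k"] double_sum3_id[of 0 k] double_sum3_id[of 2 k]
    by (simp add: algebra_simps)
  moreover have "2 * int (p3 (6 * k + 1)) = 2 * int (k * (3 * k + 1))"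
    using low[of 1] double_sum3_id[of 2 "2 * k"] double_sum3_id[of 1 k] double_sum3_id[of 2 k]
    by (simp add: algebra_simps)
  moreover have "2 * int (p3 (6 * k + 2)) = 2 * int (k * (3 * k + 2))"
    using low[of 2] double_sum3_id[of 3 "2 * k"] double_sum3_id[of 1 k] double_sum3_id[of 3 k]
    by (simp add: algebra_simps)
  moreover have "2 * int (p3 (6 * k + 3)) = 2 * int (3 * k * k + 3 * k + 1)"
    using high[of 0] double_sum3_id[of 1 "2 * k + 1"] double_sum3_id[of 0 "k + 1"]
      double_sum3_id[of 2 k]
    by (simp add: algebra_simps)
  moreover have "2 * int (p3 (6 * k + 4)) = 2 * int ((3 * k + 1) * (k + 1))"
    using high[of 1] double_sum3_id[of 2 "2 * k + 1"] double_sum3_id[of 1 "k + 1"]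
      double_sum3_id[of 2 k]
    by (simp add: algebra_simps)
  moreover have "2 * int (p3 (6 * k + 5)) = 2 * int ((3 * k + 2) * (k + 1))"
    using high[of 2] double_sum3_id[of 3 "2 * k + 1"] double_sum3_id[of 1 "k + 1"]
      double_sum3_id[of 3 k]
    by (simp add: algebra_simps)
  ultimately show
    "p3 (6 * k) = 3 * k * k"
    "p3 (6 * k + 1) = k * (3 * k + 1)"
    "p3 (6 * k + 2) = k * (3 * k + 2)"
    "p3 (6 * k + 3) = 3 * k * k + 3 * k + 1"
    "p3 (6 * k + 4) = (3 * k + 1) * (k + 1)"
    "p3 (6 * k + 5) = (3 * k + 2) * (k + 1)"
    by (simp_all only: mult_cancel_left of_nat_eq_iff) simp_all
qed

section \<open>Cancellation modulo a prime\<close>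

lemma prime_2_mod_3_not_dvd:
  fixes m y :: nat
  assumes "prime m" "m mod 3 = 2" "m \<noteq> 2"
  shows "\<not> m dvd y ^ 2 + y + 1"
proof
  assume dvd: "m dvd y ^ 2 + y + 1"
  have "\<not> m dvd y"
  proof
    assume "m dvd y"
    then have "m dvd y ^ 2 + y"
      by (simp add: power2_eq_square)
    with dvd have "m dvd 1"
      using dvd_add_right_iff by blast
    then show False
      using assms(1) by simp
  qed
  then have fermat: "[y ^ (m - 1) = 1] (mod m)"
    using assms(1) by (rule fermat_theorem[rotated])
  \<comment> \<open>Reducing \<open>y ^ 3 + y ^ 2 + y + 1\<close> in two ways gives
    \<open>y ^ 3 = 1\<close> modulo \<open>m\<close> without subtraction on naturals.\<close>
  have "[1 + y * (y ^ 2 + y + 1) = 1 + y * 0] (mod m)"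
    using dvd by (intro cong_add cong_mult cong_refl) (simp add: cong_0_iff)
  then have "[y ^ 3 + (y ^ 2 + y + 1) = 1 + 0] (mod m)"
    by (simp add: power2_eq_square power3_eq_cube algebra_simps)
  moreover have "[y ^ 3 + (y ^ 2 + y + 1) = y ^ 3 + 0] (mod m)"
    using dvd by (intro cong_add cong_refl) (simp add: cong_0_iff)
  ultimately have cube: "[y ^ 3 = 1] (mod m)"
    by (metis add_0_right cong_sym cong_trans)
  \<comment> \<open>As \<open>m - 1\<close> is 1 modulo 3, the cube relation turns Fermat's
    \<open>y ^ (m - 1) = 1\<close> into \<open>y = 1\<close> modulo \<open>m\<close>, where
    \<open>y ^ 2 + y + 1\<close> becomes 3.\<close>
  have "m - 1 = 3 * ((m - 1) div 3) + 1"
    using assms(2) by presburger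
  then have "y ^ (m - 1) = (y ^ 3) ^ ((m - 1) div 3) * y"
    by (metis power_add power_mult power_one_right)
  moreover have "[(y ^ 3) ^ ((m - 1) div 3) * y = 1 ^ ((m - 1) div 3) * y] (mod m)"
    by (intro cong_mult cong_pow cube cong_refl)
  ultimately have "[y = 1] (mod m)"
    using fermat by (metis cong_sym cong_trans mult_1 power_one)
  then have "[y ^ 2 + y + 1 = 1 ^ 2 + 1 + 1] (mod m)"
    by (intro cong_add cong_pow cong_refl)
  then have "m dvd 3"
    using dvd by (simp add: cong_def mod_eq_0_iff_dvd numeral_3_eq_3)
  then have "m = 1 \<or> m = 3"
    using prime_nat_iff[of 3] by auto
  then show False
    using assms by auto
qed

lemma sum_P3_diff_eq_0:
  fixes m :: nat and g :: "int \<Rightarrow> int"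
  assumes m: "prime m" "m mod 3 = 2" "m \<noteq> 2" and g: "\<And>x. g (x mod int m) = g x"
    and dvd: "m dvd p3 n"
  shows "(\<Sum>(l1, l2, l3)\<in>P3 n. g (l1 - l3 + 1) - g (l1 - l3)) = 0" (is "?S n = 0")
proof -
  define k where "k = n div 6"
  have m0: "m > 0"
    using m(1) by (rule prime_gt_0_nat)
  have nd3: "\<not> m dvd 3"
    using m prime_nat_iff[of 3] by auto
  have "coprime 3 m"
    using m(1) nd3 by (simp add: prime_imp_coprime coprime_commute)
  then have c: "coprime 3 (int m)"
    by (metis coprime_int_iff of_nat_numeral)
  note mult = sum3_multiple[of g m, OF g c m0]
  note pd = prime_dvd_mult_iff[OF m(1)]
  \<comment> \<open>The long positive progression is cut in two, to be matched against the two
    negative ones.\<close>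
  have split: "sum3 g a (2 * K) = sum3 g a K + sum3 g (a + 3 * int K) K"
    "sum3 g a (Suc (2 * K)) = sum3 g a K + sum3 g (a + 3 * int K) (Suc K)" for a K
    using sum3_add[of g a K K] sum3_add[of g a K "Suc K"] by (simp_all add: mult_2)
  \<comment> \<open>If \<open>m\<close> divides the linear factor \<open>3 * k + e\<close>, the
    second half starts at 1 modulo \<open>m\<close>, like the negative progression left
    over.\<close>
  have shift: "sum3 g (b + 3 * int k) N = sum3 g 1 N" if "m dvd 3 * k + e" "b = int e + 1" for b e N
  proof (rule sum3_cong[of g "int m", OF g])
    have "int m dvd 3 * int k + int e"
      using that(1) by (metis of_nat_add of_nat_dvd_iff of_nat_mult of_nat_numeral)
    then show "[b + 3 * int k = 1] (mod int m)"
      using that(2) by (simp add: cong_iff_dvd_diff algebra_simps)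
  qed
  have "n = 6 * k \<or> n = 6 * k + 1 \<or> n = 6 * k + 2 \<or> n = 6 * k + 3 \<or> n = 6 * k + 4 \<or> n = 6 * k + 5"
    unfolding k_def by presburger
  then consider "n = 6 * k" | "n = 6 * k + 1" | "n = 6 * k + 2" | "n = 6 * k + 3"
    | "n = 6 * k + 4" | "n = 6 * k + 5"
    by blast
  then show ?thesis
  proof cases
    case 1
    then have "m dvd k"
      using dvd nd3 by (simp add: p3_values pd)
    then show ?thesis
      using sum_P3_diff_low[of 0 g k] 1 by (simp add: split mult)
  next
    case 2
    then have "m dvd k \<or> m dvd 3 * k + 1"
      using dvd by (simp only: p3_values pd)
    then show ?thesis
      using sum_P3_diff_low[of 1 g k] 2 shift[of 1 2] by (auto simp: split mult)
  next
    case 3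
    then have "m dvd k \<or> m dvd 3 * k + 2"
      using dvd by (simp only: p3_values pd)
    then show ?thesis
      using sum_P3_diff_low[of 2 g k] 3 shift[of 2 3] by (auto simp: split mult)
  next
    case 4
    \<comment> \<open>Tripling \<open>3 * k * k + 3 * k + 1\<close> gives
      \<open>y ^ 2 + y + 1\<close> at \<open>y = 3 * k + 1\<close>, so this case cannot
      occur.\<close>
    have "(3 * k + 1) ^ 2 + (3 * k + 1) + 1 = 3 * p3 n"
      unfolding 4 p3_values by (simp add: power2_eq_square algebra_simps)
    then have "m dvd (3 * k + 1) ^ 2 + (3 * k + 1) + 1"
      using dvd by simp
    then show ?thesis
      using prime_2_mod_3_not_dvd[OF m] by blast
  next
    case 5
    then have "m dvd 3 * k + 1 \<or> m dvd k + 1"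
      using dvd by (simp only: p3_values pd)
    \<comment> \<open>The \<open>k\<close> terms starting at 2 cancel. The remaining sums agree by
      \<open>shift\<close>, or because both run over full periods when \<open>m\<close> divides
      \<open>k + 1\<close>.\<close>
    moreover have "?S n = sum3 g (2 + 3 * int k) (k + 1) - sum3 g 1 (k + 1)"
      using sum_P3_diff_high[of 1 g k] 5 by (simp add: split add.commute)
    ultimately show ?thesis
      using shift[of 1 2] mult[of "k + 1"] by auto
  next
    case 6
    then have "m dvd 3 * k + 2 \<or> m dvd k + 1"
      using dvd by (simp only: p3_values pd)
    moreover have "?S n = sum3 g (3 + 3 * int k) (k + 1) - sum3 g 1 (k + 1)"
      using sum_P3_diff_high[of 2 g k] 6 by (simp add: split add.commute)
    ultimately show ?thesis
      using shift[of 2 3] mult[of "k + 1"] by auto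
  qed
qed

section \<open>Equal sizes of the residue classes\<close>

lemma card_residue_class:
  fixes m :: nat
  assumes m: "prime m" "m mod 3 = 2" "m \<noteq> 2" and dvd: "m dvd p3 n" and i: "i \<in> {0..<int m}"
  shows "m * card {(l1, l2, l3) \<in> P3 n. [l1 - l3 = i] (mod int m)} = p3 n"
proof -
  define C :: "int \<Rightarrow> int" where
    "C i = (\<Sum>(l1, l2, l3)\<in>P3 n. of_bool ([l1 - l3 = i] (mod int m)))" for i
  have C_card: "C i = int (card {(l1, l2, l3) \<in> P3 n. [l1 - l3 = i] (mod int m)})" for i
    by (simp add: C_def case_prod_unfold of_bool_def flip: sum.inter_filter)
  have step: "C (i + 1) = C i" for i
  proof -
    \<comment> \<open>Shifting the indicator of class \<open>i + 1\<close> by one gives that of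
      class \<open>i\<close>, so the vanishing sum compares neighbouring classes.\<close>
    define g :: "int \<Rightarrow> int" where "g x = of_bool ([x = i + 1] (mod int m))" for x
    have "g (x + 1) = of_bool ([x = i] (mod int m))" for x
      by (simp add: g_def cong_add_rcancel)
    then have "(\<Sum>(l1, l2, l3)\<in>P3 n. g (l1 - l3 + 1) - g (l1 - l3)) = C i - C (i + 1)"
      by (simp add: C_def g_def case_prod_unfold sum_subtractf)
    moreover have "g (x mod int m) = g x" for x
      by (simp add: g_def cong_def)
    ultimately show ?thesis
      using sum_P3_diff_eq_0[OF m _ dvd, of g] by simp
  qed
  have const: "C (int k) = C 0" for k
  proof (induction k)
    case (Suc k)
    then show ?case
      using step[of "int k"] by (simp add: add.commute)
  qed simp
  have C_eq: "C k = C 0" if "k \<in> {0..<int m}" for k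
    using const[of "nat k"] that by simp
  have one: "(\<Sum>k\<in>{0..<int m}. of_bool ([x = k] (mod int m))) = (1 :: int)" for x
  proof -
    have "(\<Sum>k\<in>{0..<int m}. of_bool ([x = k] (mod int m))) =
        (\<Sum>k\<in>{0..<int m}. if k = x mod int m then 1 else 0 :: int)"
      by (intro sum.cong refl) (auto simp: cong_def)
    then show ?thesis
      using prime_gt_0_nat[OF m(1)] by simp
  qed
  \<comment> \<open>Each partition lies in exactly one of the \<open>m\<close> classes, so
    \<open>m\<close> equal counts add up to \<open>p3 n\<close>.\<close>
  have "(\<Sum>k\<in>{0..<int m}. C k) = (\<Sum>k\<in>{0..<int m}. C i)"
    by (intro sum.cong refl) (metis C_eq i)
  then have "int m * C i = (\<Sum>k\<in>{0..<int m}. C k)"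
    by simp
  also have "\<dots> = int (p3 n)"
    unfolding C_def by (subst sum.swap) (simp add: case_prod_unfold one p3_def)
  finally show ?thesis
    by (simp only: C_card of_nat_mult[symmetric] of_nat_eq_iff)
qed

theorem theorem1:
  fixes m j :: nat
  assumes "j > 0" and "m = 6 * j - 1" and "prime m"
  shows "(\<forall>n. m dvd p3 n \<longrightarrow>
           (\<forall>i\<in>{0..<int m}.
              real (card {(l1, l2, l3) \<in> P3 n. [l1 - l3 = i] (mod int m)})
                = real (p3 n) / real m))
         \<and> supercrank m (c_LS m)"
proof -
  \<comment> \<open>Since \<open>j > 0\<close>, the truncated subtractions are exact and the residue
    2 modulo 3 becomes visible.\<close>
  have "m = 2 + (2 * j - 1) * 3"
    using assms(1,2) by simp
  then have "m mod 3 = 2"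
    by (simp only: mod_mult_self1) simp
  moreover have "m \<noteq> 2"
    using assms(1,2) by simp
  ultimately have m: "prime m" "m mod 3 = 2" "m \<noteq> 2"
    using assms(3) by blast+
  have m0: "m > 0"
    using m(1) by (rule prime_gt_0_nat)
  note card = card_residue_class[OF m]
  have fibre: "c_LS m -` {i} \<inter> P3 n = {(l1, l2, l3) \<in> P3 n. [l1 - l3 = i] (mod int m)}"
    if "i \<in> {0..<int m}" for n i
    using that by (auto simp: c_LS_def cong_def)
  have "real (card {(l1, l2, l3) \<in> P3 n. [l1 - l3 = i] (mod int m)}) = real (p3 n) / real m"
    if "m dvd p3 n" "i \<in> {0..<int m}" for n i
    using card[OF that] m0 by (simp add: field_simps flip: of_nat_mult)
  moreover have "c_LS m ` (\<Union>n. P3 n) \<subseteq> {0..<int m}"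
    using m0 by (auto simp: c_LS_def)
  moreover have "card (c_LS m -` {i} \<inter> P3 n) = card (c_LS m -` {k} \<inter> P3 n)"
    if "m dvd p3 n" "i \<in> {0..<int m}" "k \<in> {0..<int m}" for n i k
  proof -
    have "m * card (c_LS m -` {i} \<inter> P3 n) = m * card (c_LS m -` {k} \<inter> P3 n)"
      by (simp only: fibre that card)
    then show ?thesis
      using m0 by simp
  qed
  ultimately show ?thesis
    unfolding supercrank_def by blast
qed

end
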